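(* There is a simple closed curve in $\mathbb{R}^3$ whose range $\Gamma$ satisfies $\frac{1}{2}(\Gamma+\Gamma)=[0,1]^3=\mathsf{co}(\Gamma)$.
   Context: A simple closed curve in a space $X$ is a continuous injection from the unit circle $\mathbb{S}^1\subseteq\mathbb{R}^2$ to $X$. For sets $A,B\subseteq\mathbb{R}^3$, $A+B$ denotes the Minkowski sum $\{x+y : x\in A,\ y\in B\}$, and for $r\in\mathbb{R}$, $rA=\{rx : x\in A\}$. $\mathsf{co}(A)$ denotes the convex hull of $A$. *)

theory Defs
  imports "HOL-Analysis.Analysis" "HOL-Library.Set_Algebras"
begin

(* Only the values of \<gamma> on the unit circle matter. On sets, + is the Minkowski sum of
   Set_Algebras. *)

definition simple_closed_curve :: "(real ^ 2 \<Rightarrow> 'a::topological_space) \<Rightarrow> bool" where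
  "simple_closed_curve \<gamma> \<longleftrightarrow> continuous_on (sphere 0 1) \<gamma> \<and> inj_on \<gamma> (sphere 0 1)"

definition unit_cube :: "(real ^ 3) set" where
  "unit_cube = {x. \<forall>i. x $ i \<in> {0..1}}"

end

theory Submission
  imports Defs
begin

text \<open>
  Every number in \<open>[0, 2]\<close> is a sum of two elements of a middle-thirds Cantor set \<open>C\<close>, so a simple
  closed curve in the cube passes the test as soon as it runs through all of \<open>C \<times> C \<times> C\<close>: the
  midpoints of its range then fill the cube, and since they lie in the convex hull of the range,
  that hull is the whole cube too.

  To find such a curve, \<open>C\<close> is first replaced by a much sparser Cantor set \<open>G\<close>, the numbers whose
  base 9 digits are all 0 or 8. An increasing homeomorphism \<open>h\<close> of \<open>[0, 1]\<close> onto itself takes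
  \<open>G\<close> to a set invariant under the two contractions of the middle-thirds set
  (\<open>stretch_sparse_cantor\<close>), and this invariance is all that the statement about sums needs
  (\<open>cantor_sum\<close>). Acting in each coordinate, \<open>h\<close> is injective and continuous on
  the cube, so a simple closed curve through \<open>G \<times> G \<times> G\<close> is good enough. The gain is that \<open>G\<close> is so
  sparse that the linear functionals \<open>\<plusminus> 4 x \<plusminus> 2 y \<plusminus> z\<close> are injective on \<open>G \<times> G \<times> G\<close>
  (\<open>sparse_cantor_linear_independence\<close>).

  If a linear functional is injective on a compact set, then visiting the points in the order of
  their values, and bridging each gap in the values by a straight segment, gives an arc through
  the whole set: the functional maps it homeomorphically to an interval (\<open>arc_through_compact\<close>).
  A single arc of this kind runs between opposite corners of the cube and cannot be closed up
  easily. Hence \<open>G \<times> G \<times> G\<close> is cut into the four columns over the corners of the square. In the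
  column \<open>[0, 1/9] \<times> [0, 1/9] \<times> [0, 1]\<close> the ends of the arc can be chosen to be \<open>(1/9, 0, 1)\<close> and
  \<open>(0, 1/9, 0)\<close>, both of which face a neighbouring column. A quarter turn about the vertical axis
  of the cube, combined with a reflection of the third coordinate, carries each column to
  the next one; the four images of the arc, joined by four edge-parallel segments that cross
  between the columns, form a simple loop.
\<close>

section \<open>Arcs through compact sets with an injective linear functional\<close>

text \<open>
  Pairs \<open>(p, p)\<close> are included on purpose: they make the set of pairs closed when pairs of
  neighbours accumulate at a point, and they put \<open>K\<close> itself into the chain below.
\<close>

definition consecutive :: "('a \<Rightarrow> real) \<Rightarrow> 'a set \<Rightarrow> ('a \<times> 'a) set" where
  "consecutive L K =
    {(p, q) \<in> K \<times> K. L p \<le> L q \<and> (\<forall>r\<in>K. L r \<le> L p \<or> L q \<le> L r)}"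

definition chain :: "('a::real_vector \<Rightarrow> real) \<Rightarrow> 'a set \<Rightarrow> 'a set" where
  "chain L K = (\<Union>(p, q)\<in>consecutive L K. closed_segment p q)"

lemma subset_chain: "K \<subseteq> chain L K"
proof
  fix p assume "p \<in> K"
  then have "(p, p) \<in> consecutive L K"
    by (auto simp: consecutive_def)
  then show "p \<in> chain L K"
    by (force simp: chain_def)
qed

lemma chain_subset_hull: "chain L K \<subseteq> convex hull K"
proof -
  have "closed_segment p q \<subseteq> convex hull K" if "(p, q) \<in> consecutive L K" for p q
    using that by (intro closed_segment_subset hull_inc convex_convex_hull) (auto simp: consecutive_def)
  then show ?thesis
    unfolding chain_def by blast
qed

text \<open>
  A limit of pairs without an intermediate value cannot acquire one: having a given intermediate
  value \<open>L r\<close> is an open condition on the pair.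
\<close>

lemma compact_consecutive:
  fixes L :: "'a::t2_space \<Rightarrow> real"
  assumes K: "compact K" and L: "continuous_on K L"
  shows "compact (consecutive L K)"
proof -
  have 1: "continuous_on (K \<times> K) (\<lambda>z. L (fst z))"
    by (rule continuous_on_compose2[OF L]) (auto intro: continuous_intros)
  have 2: "continuous_on (K \<times> K) (\<lambda>z. L (snd z))"
    by (rule continuous_on_compose2[OF L]) (auto intro: continuous_intros)
  have KK: "closed (K \<times> K)"
    using K by (simp add: compact_imp_closed compact_Times)
  have le: "closed {z \<in> K \<times> K. L (fst z) \<le> L (snd z)}"
    using continuous_on_closed_Collect_le[OF 1 2 KK] by simp
  have gap: "closed {z \<in> K \<times> K. L r \<le> L (fst z) \<or> L (snd z) \<le> L r}" for r
  proof -
    have "closed {z \<in> K \<times> K. L r \<le> L (fst z)}" "closed {z \<in> K \<times> K. L (snd z) \<le> L r}"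
      by (intro continuous_on_closed_Collect_le 1 2 KK continuous_on_const)+
    then have "closed ({z \<in> K \<times> K. L r \<le> L (fst z)} \<union> {z \<in> K \<times> K. L (snd z) \<le> L r})"
      by (rule closed_Un)
    then show ?thesis
      by (rule back_subst[of closed]) auto
  qed
  have eq: "consecutive L K = (K \<times> K) \<inter> ({z \<in> K \<times> K. L (fst z) \<le> L (snd z)} \<inter>
      (\<Inter>r\<in>K. {z \<in> K \<times> K. L r \<le> L (fst z) \<or> L (snd z) \<le> L r}))"
    by (auto simp: consecutive_def)
  show ?thesis
    unfolding eq
    by (intro compact_Int_closed[OF compact_Times[OF K K]] closed_Int closed_INT ballI le gap)
qed

lemma compact_chain:
  fixes L :: "'a::real_normed_vector \<Rightarrow> real"
  assumes K: "compact K" and L: "continuous_on K L"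
  shows "compact (chain L K)"
proof -
  have "chain L K = (\<lambda>((p, q), s). (1 - s) *\<^sub>R p + s *\<^sub>R q) ` (consecutive L K \<times> {0..1})"
  proof (intro subset_antisym subsetI)
    fix x assume "x \<in> chain L K"
    then obtain p q s where "(p, q) \<in> consecutive L K" "s \<in> {0..1}" "x = (1 - s) *\<^sub>R p + s *\<^sub>R q"
      unfolding chain_def closed_segment_def by auto
    then show "x \<in> (\<lambda>((p, q), s). (1 - s) *\<^sub>R p + s *\<^sub>R q) ` (consecutive L K \<times> {0..1})"
      by (intro image_eqI[of _ _ "((p, q), s)"]) auto
  next
    fix x assume "x \<in> (\<lambda>((p, q), s). (1 - s) *\<^sub>R p + s *\<^sub>R q) ` (consecutive L K \<times> {0..1})"
    then obtain p q s where pq: "(p, q) \<in> consecutive L K"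
      and "s \<in> {0..1}" "x = (1 - s) *\<^sub>R p + s *\<^sub>R q"
      by auto
    then have "x \<in> closed_segment p q" by (auto simp: closed_segment_def)
    then show "x \<in> chain L K" using pq by (auto simp: chain_def)
  qed
  moreover have "continuous_on (consecutive L K \<times> {0..1})
      (\<lambda>((p, q), s). (1 - s) *\<^sub>R p + s *\<^sub>R q)"
    unfolding case_prod_unfold by (intro continuous_intros)
  ultimately show ?thesis
    using compact_consecutive[OF K L] by (simp add: compact_Times compact_continuous_image)
qed

lemma linear_on_segment:
  fixes L :: "'a::real_vector \<Rightarrow> real"
  assumes "linear L"
  shows "L ((1 - s) *\<^sub>R p + s *\<^sub>R q) = L p + s * (L q - L p)"
  using assms by (simp add: linear_add linear_cmul) (simp add: algebra_simps)

lemma segment_point_eqI: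
  fixes L :: "'a::real_vector \<Rightarrow> real"
  assumes L: "linear L" and inj: "inj_on L K" and pq: "p \<in> K" "q \<in> K"
    and x: "x \<in> closed_segment p q" and y: "y \<in> closed_segment p q" and xy: "L x = L y"
  shows "x = y"
proof -
  obtain s where s: "x = (1 - s) *\<^sub>R p + s *\<^sub>R q" using x by (auto simp: closed_segment_def)
  obtain t where t: "y = (1 - t) *\<^sub>R p + t *\<^sub>R q" using y by (auto simp: closed_segment_def)
  have "s * (L q - L p) = t * (L q - L p)"
    using xy by (simp add: s t linear_on_segment[OF L])
  then have "s = t \<or> p = q"
    using inj pq by (auto dest: inj_onD)
  then show ?thesis
    by (auto simp: s t simp flip: scaleR_left_distrib)
qed

lemma linear_on_segment_bounds:
  fixes L :: "'a::real_vector \<Rightarrow> real"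
  assumes L: "linear L" and x: "x \<in> closed_segment p q" and pq: "L p \<le> L q"
  shows "L p \<le> L x" "L x \<le> L q"
proof -
  obtain s where s: "x = (1 - s) *\<^sub>R p + s *\<^sub>R q" "0 \<le> s" "s \<le> 1"
    using x by (auto simp: closed_segment_def)
  have "0 \<le> s * (L q - L p)" "s * (L q - L p) \<le> 1 * (L q - L p)"
    using s pq by (simp, intro mult_right_mono) auto
  then show "L p \<le> L x" "L x \<le> L q"
    by (simp_all add: s(1) linear_on_segment[OF L])
qed

text \<open>
  The value intervals of two pairs of neighbours are equal, or meet in at most an end point. In
  the first case the pairs are equal because \<open>L\<close> is injective on \<open>K\<close>; in the second case the
  common value is attained only at the common end point.
\<close>

lemma inj_on_chain:
  fixes L :: "'a::real_vector \<Rightarrow> real"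
  assumes L: "linear L" and inj: "inj_on L K"
  shows "inj_on L (chain L K)"
proof -
  have aux: "x = y" if "(p, q) \<in> consecutive L K" "x \<in> closed_segment p q"
    "(p', q') \<in> consecutive L K" "y \<in> closed_segment p' q'" "L x = L y" "L p \<le> L p'"
    for x y p q p' q'
  proof -
    note le = that(6)
    have K: "p \<in> K" "q \<in> K" "p' \<in> K" "q' \<in> K" "L p \<le> L q" "L p' \<le> L q'"
      and gap: "L p' \<le> L p \<or> L q \<le> L p'" "L q' \<le> L p \<or> L q \<le> L q'" "L q \<le> L p' \<or> L q' \<le> L q"
      using that by (auto simp: consecutive_def)
    have b: "L p \<le> L x" "L x \<le> L q" "L p' \<le> L x" "L x \<le> L q'"
      using linear_on_segment_bounds[OF L that(2) K(5)] linear_on_segment_bounds[OF L that(4) K(6)] that(5)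
      by auto
    \<comment> \<open>Same interval; the first ends where the second begins; the first is the single value \<open>L p\<close>
      or the second is the single value \<open>L p'\<close>, at a common left end.\<close>
    consider "L p = L p'" "L q = L q'" | "L q = L p'" "L x = L q" | "L p = L p'" "L x = L p"
      using gap b le K by linarith
    then show ?thesis
    proof cases
      case 1
      then have "p = p'" "q = q'" using inj K by (auto dest: inj_onD)
      then show ?thesis using segment_point_eqI[OF L inj] K that by blast
    next
      case 2
      then have "q = p'" using inj K by (auto dest: inj_onD)
      moreover have "x = q" using segment_point_eqI[OF L inj K(1,2) that(2) _ 2(2)] by simp
      moreover have "y = p'" using segment_point_eqI[OF L inj K(3,4) that(4), of p'] 2 that(5) by simp
      ultimately show ?thesis by simp
    next
      case 3
      then have "p = p'" using inj K by (auto dest: inj_onD)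
      moreover have "x = p" using segment_point_eqI[OF L inj K(1,2) that(2) _ 3(2)] by simp
      moreover have "y = p'" using segment_point_eqI[OF L inj K(3,4) that(4), of p'] 3 that(5) by simp
      ultimately show ?thesis by simp
    qed
  qed
  show ?thesis
  proof (rule inj_onI)
    fix x y assume xy: "x \<in> chain L K" "y \<in> chain L K" "L x = L y"
    obtain p q where pq: "(p, q) \<in> consecutive L K" "x \<in> closed_segment p q"
      using xy(1) by (auto simp: chain_def)
    obtain p' q' where pq': "(p', q') \<in> consecutive L K" "y \<in> closed_segment p' q'"
      using xy(2) by (auto simp: chain_def)
    show "x = y"
      using aux[OF pq pq' xy(3)] aux[OF pq' pq xy(3)[symmetric]] by fastforce
  qed
qed

lemma image_chain:
  fixes L :: "'a::real_normed_vector \<Rightarrow> real"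
  assumes K: "compact K" and L: "linear L" and cont: "continuous_on K L"
    and ab: "a \<in> K" "b \<in> K" and le: "\<And>x. x \<in> K \<Longrightarrow> L a \<le> L x \<and> L x \<le> L b"
  shows "L ` chain L K = {L a..L b}"
proof (rule subset_antisym)
  show "L ` chain L K \<subseteq> {L a..L b}"
  proof clarify
    fix x assume "x \<in> chain L K"
    then obtain p q where pq: "(p, q) \<in> consecutive L K" "x \<in> closed_segment p q"
      by (auto simp: chain_def)
    then have "p \<in> K" "q \<in> K" "L p \<le> L x" "L x \<le> L q"
      using linear_on_segment_bounds[OF L pq(2)] by (auto simp: consecutive_def)
    then show "L x \<in> {L a..L b}"
      using le[of p] le[of q] by auto
  qed
next
  show "{L a..L b} \<subseteq> L ` chain L K"
  proof
    fix t assume t: "t \<in> {L a..L b}"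
    have closed: "closed {x \<in> K. L x \<le> t}" "closed {x \<in> K. t \<le> L x}"
      by (intro continuous_on_closed_Collect_le cont continuous_on_const compact_imp_closed K)+
    have cpt: "compact {x \<in> K. L x \<le> t}" "compact {x \<in> K. t \<le> L x}"
      using compact_Int_closed[OF K closed(1)] compact_Int_closed[OF K closed(2)]
      by (simp_all add: Int_def conj_commute cong: conj_cong)
    have "\<exists>p\<in>{x \<in> K. L x \<le> t}. \<forall>r\<in>{x \<in> K. L x \<le> t}. L r \<le> L p"
      using t ab by (intro continuous_attains_sup cpt continuous_on_subset[OF cont]) auto
    then obtain p where p: "p \<in> K" "L p \<le> t" "\<And>r. r \<in> K \<Longrightarrow> L r \<le> t \<Longrightarrow> L r \<le> L p" by auto
    have "\<exists>q\<in>{x \<in> K. t \<le> L x}. \<forall>r\<in>{x \<in> K. t \<le> L x}. L q \<le> L r"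
      using t ab by (intro continuous_attains_inf cpt continuous_on_subset[OF cont]) auto
    then obtain q where q: "q \<in> K" "t \<le> L q" "\<And>r. r \<in> K \<Longrightarrow> t \<le> L r \<Longrightarrow> L q \<le> L r" by auto
    have pq: "(p, q) \<in> consecutive L K"
    proof -
      have "L r \<le> L p \<or> L q \<le> L r" if "r \<in> K" for r
        using p(3)[OF that] q(3)[OF that] by linarith
      then show ?thesis
        unfolding consecutive_def using p(1,2) q(1,2) by simp
    qed
    \<comment> \<open>If \<open>t\<close> is itself a value on \<open>K\<close>, both values agree and division by zero gives \<open>s = 0\<close>.\<close>
    define s where "s = (t - L p) / (L q - L p)"
    have s: "0 \<le> s" "s \<le> 1" "L p + s * (L q - L p) = t"
      using p(2) q(2) by (auto simp: s_def divide_le_eq)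
    then have "(1 - s) *\<^sub>R p + s *\<^sub>R q \<in> closed_segment p q"
      by (auto simp: closed_segment_def)
    then have "(1 - s) *\<^sub>R p + s *\<^sub>R q \<in> chain L K"
      using pq by (auto simp: chain_def)
    moreover have "L ((1 - s) *\<^sub>R p + s *\<^sub>R q) = t"
      by (simp add: linear_on_segment[OF L] s(3))
    ultimately show "t \<in> L ` chain L K" by blast
  qed
qed

lemma arc_compose:
  assumes "arc \<gamma>" "continuous_on (path_image \<gamma>) f" "inj_on f (path_image \<gamma>)"
  shows "arc (f \<circ> \<gamma>)"
  using assms by (auto simp: arc_def path_image_def intro: path_continuous_image comp_inj_on)

text \<open>
  The functional is a continuous bijection from the compact chain to an interval, hence a
  homeomorphism, and its inverse parametrizes the chain.
\<close>

lemma arc_through_compact: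
  fixes L :: "'a::euclidean_space \<Rightarrow> real"
  assumes K: "compact K" and L: "linear L" and inj: "inj_on L K"
    and ab: "a \<in> K" "b \<in> K" "L a < L b" and le: "\<And>x. x \<in> K \<Longrightarrow> L a \<le> L x \<and> L x \<le> L b"
  obtains \<gamma> where "arc \<gamma>" "pathstart \<gamma> = a" "pathfinish \<gamma> = b"
    "K \<subseteq> path_image \<gamma>" "path_image \<gamma> \<subseteq> convex hull K"
proof -
  have cont: "continuous_on S L" for S
    using L by (simp add: linear_continuous_on linear_conv_bounded_linear)
  obtain g where g: "homeomorphism (chain L K) {L a..L b} L g"
    using homeomorphism_compact[OF compact_chain[OF K cont] cont image_chain[OF K L cont ab(1,2) le]
        inj_on_chain[OF L inj]] by blast
  have gL: "g (L x) = x" if "x \<in> K" for x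
    using homeomorphism_apply1[OF g] subset_chain[of K L] that by blast
  define \<gamma> where "\<gamma> = (g \<circ> linepath (L a) (L b))"
  have lp: "path_image (linepath (L a) (L b)) = {L a..L b}"
    using ab(3) by (simp add: closed_segment_eq_real_ivl)
  have "arc \<gamma>"
    unfolding \<gamma>_def
  proof (rule arc_compose)
    show "arc (linepath (L a) (L b))" using ab(3) by simp
    show "continuous_on (path_image (linepath (L a) (L b))) g"
      unfolding lp by (rule homeomorphism_cont2[OF g])
    show "inj_on g (path_image (linepath (L a) (L b)))"
      unfolding lp by (rule inj_on_inverseI[where g=L]) (use homeomorphism_apply2[OF g] in auto)
  qed
  moreover have "path_image \<gamma> = chain L K"
    unfolding \<gamma>_def path_image_compose lp by (rule homeomorphism_image2[OF g])
  moreover have "pathstart \<gamma> = a" "pathfinish \<gamma> = b"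
    using gL ab by (auto simp: \<gamma>_def pathstart_compose pathfinish_compose)
  ultimately show thesis
    using that subset_chain chain_subset_hull by blast
qed

section \<open>A sparse Cantor set\<close>

text \<open>
  The numbers in \<open>[0, 1]\<close> with a base 9 expansion into the digits 0 and 8. As the largest set
  of numbers in \<open>[0, 1]\<close> from which such digits can be split off forever, it contains 0, 1, the
  mirror images of its elements, and all its limit points by mere coinduction, with no series.
\<close>

coinductive_set sparse_cantor :: "real set" where
  "y \<in> sparse_cantor \<Longrightarrow> d \<in> {0, 1} \<Longrightarrow> (8 * d + y) / 9 \<in> {0..1} \<Longrightarrow>
    (8 * d + y) / 9 \<in> sparse_cantor"

lemma sparse_cantor_coinduct_set:
  assumes "x \<in> X" "X \<subseteq> {0..1}" "\<And>x. x \<in> X \<Longrightarrow> \<exists>d\<in>{0, 1}. \<exists>y\<in>X. x = (8 * d + y) / 9"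
  shows "x \<in> sparse_cantor"
  using assms(1)
proof (coinduction arbitrary: x rule: sparse_cantor.coinduct)
  case (sparse_cantor x)
  then show ?case using assms(2) assms(3)[of x] by fastforce
qed

lemma sparse_cantor_subset: "sparse_cantor \<subseteq> {0..1}"
  by (auto elim: sparse_cantor.cases)

lemma sparse_cantorE:
  assumes "x \<in> sparse_cantor"
  obtains d :: int and y :: real where "d \<in> {0, 1}" "y \<in> sparse_cantor" "x = (8 * real_of_int d + y) / 9"
  using assms
proof cases
  case (1 y d)
  then show thesis using that[of 0 y] that[of 1 y] by auto
qed

lemma sparse_cantorI:
  assumes "y \<in> sparse_cantor" "d \<in> {0, 1}"
  shows "(8 * d + y) / 9 \<in> sparse_cantor"
proof (rule sparse_cantor.intros[OF assms])
  show "(8 * d + y) / 9 \<in> {0..1}"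
    using assms sparse_cantor_subset by fastforce
qed

lemma zero_in_sparse_cantor: "0 \<in> sparse_cantor" and one_in_sparse_cantor: "1 \<in> sparse_cantor"
  by (rule sparse_cantor_coinduct_set[where X="{0, 1}"]; force)+

lemma reflect_sparse_cantor:
  assumes "x \<in> sparse_cantor"
  shows "1 - x \<in> sparse_cantor"
proof (rule sparse_cantor_coinduct_set[where X="(-) 1 ` sparse_cantor"])
  show "1 - x \<in> (-) 1 ` sparse_cantor" using assms by simp
  show "(-) 1 ` sparse_cantor \<subseteq> {0..1}" using sparse_cantor_subset by force
next
  fix x assume "x \<in> (-) 1 ` sparse_cantor"
  then obtain u where u: "u \<in> sparse_cantor" "x = 1 - u" by auto
  from u(1) obtain d :: int and y :: real where dy: "d \<in> {0, 1}" "y \<in> sparse_cantor" "u = (8 * real_of_int d + y) / 9"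
    by (rule sparse_cantorE)
  have "x = (8 * (1 - real_of_int d) + (1 - y)) / 9"
    using u(2) dy(3) by (simp add: field_simps)
  moreover have "1 - real_of_int d \<in> {0, 1}" using dy(1) by auto
  ultimately show "\<exists>d\<in>{0, 1}. \<exists>y\<in>(-) 1 ` sparse_cantor. x = (8 * d + y) / 9"
    using dy(2) by blast
qed

text \<open>
  The closure again allows a digit to be split off from each of its points, so the coinduction
  principle puts it inside the set.
\<close>

lemma closed_sparse_cantor: "closed sparse_cantor"
proof -
  define A where "A d = (\<lambda>y. (8 * d + y) / 9) ` closure sparse_cantor" for d :: real
  have sub01: "closure sparse_cantor \<subseteq> {0..1}"
    by (rule closure_minimal[OF sparse_cantor_subset]) simp
  then have "compact (closure sparse_cantor)"
    by (meson bounded_closed_interval bounded_subset closed_closure compact_eq_bounded_closed)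
  then have "closed (A d)" for d
    unfolding A_def by (intro compact_imp_closed compact_continuous_image continuous_intros) auto
  moreover have "sparse_cantor \<subseteq> A 0 \<union> A 1"
  proof
    fix x assume "x \<in> sparse_cantor"
    then obtain d :: int and y :: real where "d \<in> {0, 1}" "y \<in> sparse_cantor" "x = (8 * real_of_int d + y) / 9"
      by (rule sparse_cantorE)
    then show "x \<in> A 0 \<union> A 1"
      unfolding A_def using closure_subset[of sparse_cantor] by auto
  qed
  ultimately have "closure sparse_cantor \<subseteq> A 0 \<union> A 1"
    by (intro closure_minimal) auto
  then have "closure sparse_cantor \<subseteq> sparse_cantor"
    using sub01 by (intro subsetI sparse_cantor_coinduct_set[where X="closure sparse_cantor"])
      (auto simp: A_def)
  then show ?thesis
    by (metis closure_subset closed_closure subset_antisym)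
qed

lemma compact_sparse_cantor: "compact sparse_cantor"
  using closed_sparse_cantor sparse_cantor_subset
  by (meson bounded_closed_interval bounded_subset compact_eq_bounded_closed)

lemma sparse_cantor_cases:
  assumes "x \<in> sparse_cantor"
  obtains "x \<le> 1/9" | "8/9 \<le> x"
proof -
  obtain d :: int and y :: real where "d \<in> {0, 1}" "y \<in> sparse_cantor" "x = (8 * real_of_int d + y) / 9"
    using assms by (rule sparse_cantorE)
  moreover then have "0 \<le> y" "y \<le> 1" using sparse_cantor_subset by auto
  ultimately show thesis using that by auto
qed

lemma sparse_cantor_diff:
  assumes "x \<in> sparse_cantor" "y \<in> sparse_cantor"
  shows "\<bar>x - y\<bar> \<le> 1"
proof -
  have "x \<in> {0..1}" "y \<in> {0..1}" using assms sparse_cantor_subset by blast+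
  then show ?thesis by (auto simp: abs_le_iff)
qed

text \<open>
  The leading digits of the six numbers contribute 8 times an integer to the relation (after
  multiplication by 9), and the remainders at most \<open>4 + 2 + 1 = 7\<close>. So the integer is 0, and since
  \<open>4 a + 2 b + c = 0\<close> with \<open>a, b, c \<in> {-1, 0, 1}\<close> forces \<open>a = b = c = 0\<close>, the leading digits agree.
  The remainders satisfy the same relation, which permits induction on the number of digits.
\<close>

lemma sparse_cantor_digit_relation:
  assumes "u \<in> sparse_cantor" "u' \<in> sparse_cantor" "v \<in> sparse_cantor" "v' \<in> sparse_cantor"
    "w \<in> sparse_cantor" "w' \<in> sparse_cantor" "4 * (u - u') + 2 * (v - v') + (w - w') = 0"
  shows "\<bar>u - u'\<bar> \<le> (1/9) ^ n \<and> \<bar>v - v'\<bar> \<le> (1/9) ^ n \<and> \<bar>w - w'\<bar> \<le> (1/9) ^ n"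
  using assms
proof (induction n arbitrary: u u' v v' w w')
  case 0
  then show ?case by (simp add: sparse_cantor_diff)
next
  case (Suc n)
  have digit: "\<exists>d\<in>{0, 1 :: int}. \<exists>y\<in>sparse_cantor. x = (8 * real_of_int d + y) / 9" if "x \<in> sparse_cantor" for x
    using that by (rule sparse_cantorE) blast
  obtain a r where a: "a \<in> {0, 1 :: int}" "r \<in> sparse_cantor" "u = (8 * real_of_int a + r) / 9"
    using digit[OF Suc.prems(1)] by blast
  obtain a' r' where a': "a' \<in> {0, 1 :: int}" "r' \<in> sparse_cantor" "u' = (8 * real_of_int a' + r') / 9"
    using digit[OF Suc.prems(2)] by blast
  obtain b s where b: "b \<in> {0, 1 :: int}" "s \<in> sparse_cantor" "v = (8 * real_of_int b + s) / 9"
    using digit[OF Suc.prems(3)] by blast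
  obtain b' s' where b': "b' \<in> {0, 1 :: int}" "s' \<in> sparse_cantor" "v' = (8 * real_of_int b' + s') / 9"
    using digit[OF Suc.prems(4)] by blast
  obtain c t where c: "c \<in> {0, 1 :: int}" "t \<in> sparse_cantor" "w = (8 * real_of_int c + t) / 9"
    using digit[OF Suc.prems(5)] by blast
  obtain c' t' where c': "c' \<in> {0, 1 :: int}" "t' \<in> sparse_cantor" "w' = (8 * real_of_int c' + t') / 9"
    using digit[OF Suc.prems(6)] by blast
  note m = a(2) a'(2) b(2) b'(2) c(2) c'(2)
  note e = a(3) a'(3) b(3) b'(3) c(3) c'(3)
  define k where "k = 4 * (a - a') + 2 * (b - b') + (c - c')"
  have rel: "8 * real_of_int k + (4 * (r - r') + 2 * (s - s') + (t - t')) = 0"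
    using Suc.prems(7) by (simp add: e k_def field_simps)
  have "\<bar>r - r'\<bar> \<le> 1" "\<bar>s - s'\<bar> \<le> 1" "\<bar>t - t'\<bar> \<le> 1"
    using m by (auto intro: sparse_cantor_diff)
  then have "8 * real_of_int k \<le> 7" "- 7 \<le> 8 * real_of_int k"
    using rel by argo+
  then have k: "k = 0" by linarith
  then have "a = a'" "b = b'" "c = c'"
    using a(1) a'(1) b(1) b'(1) c(1) c'(1) by (auto simp: k_def)
  moreover have "4 * (r - r') + 2 * (s - s') + (t - t') = 0"
    using rel k by simp
  note Suc.IH[OF m this]
  ultimately show ?case
    by (auto simp: e abs_divide simp flip: diff_divide_distrib)
qed

lemma sparse_cantor_linear_independence:
  assumes "u \<in> sparse_cantor" "u' \<in> sparse_cantor" "v \<in> sparse_cantor" "v' \<in> sparse_cantor"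
    "w \<in> sparse_cantor" "w' \<in> sparse_cantor" "4 * (u - u') + 2 * (v - v') + (w - w') = 0"
  shows "u = u'" "v = v'" "w = w'"
proof -
  have *: "x = 0" if "\<And>n. \<bar>x\<bar> \<le> (1/9) ^ n" for x :: real
  proof -
    have "\<bar>x\<bar> \<le> 0"
      by (rule LIMSEQ_le_const[OF LIMSEQ_realpow_zero[of "1/9"]]) (use that in auto)
    then show ?thesis by simp
  qed
  show "u = u'" "v = v'" "w = w'"
    using *[of "u - u'"] *[of "v - v'"] *[of "w - w'"] sparse_cantor_digit_relation[OF assms] by auto
qed

section \<open>Stretching the sparse Cantor set to the middle-thirds Cantor set\<close>

text \<open>
  The map that stretches the sparse Cantor set should satisfy \<open>h (y / 9) = h y / 3\<close> and
  \<open>h ((8 + y) / 9) = (2 + h y) / 3\<close>, and be linear between \<open>1/9\<close> and \<open>8/9\<close>. All three requirements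
  become a single fixed point equation \<open>h = stretch_step h\<close>, since at each point
  at most one of the three ramps that occur in it is strictly between 0 and 1.
\<close>

definition ramp :: "real \<Rightarrow> real \<Rightarrow> real \<Rightarrow> real" where
  "ramp a b u = max 0 (min 1 ((u - a) / (b - a)))"

definition stretch_step :: "(real \<Rightarrow> real) \<Rightarrow> real \<Rightarrow> real" where
  "stretch_step h u = (h (ramp 0 (1/9) u) + ramp (1/9) (8/9) u + h (ramp (8/9) 1 u)) / 3"

lemma ramp_bounds: "0 \<le> ramp a b u" "ramp a b u \<le> 1"
  by (auto simp: ramp_def)

lemma continuous_on_ramp: "continuous_on S (ramp a b)"
  unfolding ramp_def by (cases "a = b") (auto intro!: continuous_intros)

lemma ramp_mono: "a < b \<Longrightarrow> u \<le> v \<Longrightarrow> ramp a b u \<le> ramp a b v"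
  unfolding ramp_def by (intro max.mono min.mono divide_right_mono) auto

lemma ramp_decomposition:
  "u \<in> {0..1} \<Longrightarrow> ramp 0 (1/9) u + 7 * ramp (1/9) (8/9) u + ramp (8/9) 1 u = 9 * u"
  by (auto simp: ramp_def max_def min_def field_simps)

text \<open>
  The operator \<open>stretch_step\<close> contracts the uniform distance by the factor \<open>2/3\<close>, so it has a
  fixed point among the bounded continuous functions. A strictly increasing one is found by
  working in the closed set of functions whose slope is at least \<open>3/7\<close>. This set is invariant:
  the slope of \<open>stretch_step h\<close> is 3 times a slope of \<open>h\<close> on the two outer
  intervals and \<open>(1/3) / (7/9) = 3/7\<close> on the middle one.
\<close>

lemma stretch_exists:
  obtains h :: "real \<Rightarrow> real" where "continuous_on UNIV h" "h 0 = 0" "h 1 = 1"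
    "strict_mono_on {0..1} h" "\<And>u. h u = stretch_step h u"
proof -
  define S :: "(real \<Rightarrow>\<^sub>C real) set" where "S = {h. apply_bcontfun h 0 = 0 \<and> apply_bcontfun h 1 = 1 \<and>
    (\<forall>u v. 0 \<le> u \<longrightarrow> u \<le> v \<longrightarrow> v \<le> 1 \<longrightarrow> 3/7 * (v - u) \<le> apply_bcontfun h v - apply_bcontfun h u)}"
  define T :: "(real \<Rightarrow>\<^sub>C real) \<Rightarrow> (real \<Rightarrow>\<^sub>C real)" where "T h = Bcontfun (stretch_step h)" for h
  have T: "T h u = stretch_step h u" for h u
  proof -
    have "stretch_step h \<in> bcontfun"
    proof (rule bcontfun_normI)
      show "continuous_on UNIV (stretch_step h)"
        unfolding stretch_step_def
        by (intro continuous_intros continuous_on_ramp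
            continuous_on_compose2[OF continuous_on_apply_bcontfun continuous_on_ramp]) auto
      have 1: "\<bar>h x\<bar> \<le> norm h" for x using norm_bounded[of h x] by simp
      show "norm (stretch_step h u) \<le> norm h + 1" for u
        using 1[of "ramp 0 (1/9) u"] 1[of "ramp (8/9) 1 u"] ramp_bounds[of "1/9" "8/9" u]
        by (auto simp: stretch_step_def)
    qed
    then show ?thesis by (simp add: T_def Bcontfun_inverse)
  qed
  have ev: "continuous_on UNIV (\<lambda>h :: real \<Rightarrow>\<^sub>C real. h u)" for u
  proof (rule continuous_onI)
    fix h :: "real \<Rightarrow>\<^sub>C real" and e :: real assume "0 < e"
    then show "\<exists>d>0. \<forall>k\<in>UNIV. dist k h < d \<longrightarrow> dist (apply_bcontfun k u) (apply_bcontfun h u) \<le> e"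
      by (intro exI[of _ e]) (auto intro: order.trans[OF dist_bounded])
  qed
  have "\<exists>!h\<in>S. T h = h"
  proof (rule Banach_fix)
    have "closed {h :: real \<Rightarrow>\<^sub>C real. apply_bcontfun h u = a}" for u a
      by (rule closed_Collect_eq[OF ev continuous_on_const])
    moreover have "closed {h :: real \<Rightarrow>\<^sub>C real. a \<le> apply_bcontfun h v - apply_bcontfun h u}" for u v a
      by (rule closed_Collect_le[OF continuous_on_const continuous_on_diff[OF ev ev]])
    moreover have "S = {h. apply_bcontfun h 0 = 0} \<inter> {h. apply_bcontfun h 1 = 1} \<inter>
        (\<Inter>u. \<Inter>v\<in>{v. 0 \<le> u \<and> u \<le> v \<and> v \<le> 1}.
          {h. 3/7 * (v - u) \<le> apply_bcontfun h v - apply_bcontfun h u})"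
      by (auto simp: S_def)
    ultimately have "closed S"
      by (simp only:) (intro closed_Int closed_INT ballI; assumption)
    then show "complete S" by (simp add: complete_eq_closed)
    have id: "ramp 0 1 \<in> bcontfun"
      by (rule bcontfun_normI[OF continuous_on_ramp]) (use ramp_bounds in \<open>auto simp: abs_le_iff intro: order.trans\<close>)
    have "Bcontfun (ramp 0 1) \<in> S"
      by (auto simp: S_def Bcontfun_inverse[OF id] ramp_def)
    then show "S \<noteq> {}" by blast
    show "0 \<le> (2/3 :: real)" "2/3 < (1::real)" by auto
    show "T ` S \<subseteq> S"
    proof clarify
      fix h assume h: "h \<in> S"
      have "3/7 * (v - u) \<le> T h v - T h u" if "0 \<le> u" "u \<le> v" "v \<le> 1" for u v
      proof -
        have sl: "3/7 * (ramp a b v - ramp a b u) \<le> h (ramp a b v) - h (ramp a b u)" if "a < b" for a b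
          using h ramp_bounds[of a b] ramp_mono[OF that \<open>u \<le> v\<close>] by (auto simp: S_def)
        have "ramp 0 (1/9) u \<le> ramp 0 (1/9) v" "ramp (1/9) (8/9) u \<le> ramp (1/9) (8/9) v"
          "ramp (8/9) 1 u \<le> ramp (8/9) 1 v"
          by (intro ramp_mono that(2); simp)+
        moreover have "ramp 0 (1/9) u + 7 * ramp (1/9) (8/9) u + ramp (8/9) 1 u = 9 * u"
          "ramp 0 (1/9) v + 7 * ramp (1/9) (8/9) v + ramp (8/9) 1 v = 9 * v"
          using that by (auto intro!: ramp_decomposition)
        ultimately show ?thesis
          using sl[of 0 "1/9"] sl[of "8/9" 1] unfolding T stretch_step_def by argo
      qed
      then show "T h \<in> S"
        using h by (auto simp: S_def T stretch_step_def ramp_def)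
    qed
    show "dist (T h) (T k) \<le> 2/3 * dist h k" for h k
    proof (rule dist_bound)
      fix u
      have 1: "\<bar>h x - k x\<bar> \<le> dist h k" for x
        using dist_bounded[of h x k] by (simp add: dist_real_def)
      show "dist (T h u) (T k u) \<le> 2/3 * dist h k"
        using 1[of "ramp 0 (1/9) u"] 1[of "ramp (8/9) 1 u"]
        unfolding T stretch_step_def dist_real_def by argo
    qed
  qed
  then obtain h where h: "h \<in> S" "T h = h" by blast
  show thesis
  proof
    show "continuous_on UNIV h" by simp
    show "h 0 = 0" "h 1 = 1" using h(1) by (auto simp: S_def)
    show "strict_mono_on {0..1} h"
    proof (rule strict_mono_onI)
      fix u v :: real assume "u \<in> {0..1}" "v \<in> {0..1}" "u < v"
      then have "3/7 * (v - u) \<le> h v - h u" "0 < v - u"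
        using h(1) by (auto simp: S_def)
      then show "h u < h v" by argo
    qed
    show "h u = stretch_step h u" for u
      using T[of h u] h(2) by simp
  qed
qed

text \<open>
  The classical argument for \<open>C + C = [0, 2]\<close>: the interval \<open>[0, 2]\<close> is the union of the three
  intervals \<open>([0, 2] + k) / 3\<close> with \<open>k \<in> {0, 2, 4}\<close>, and these \<open>k\<close> are the possible sums of two
  leading digits from \<open>{0, 2}\<close>. Repeating this gives approximate solutions, and compactness an
  exact one.
\<close>

lemma cantor_sum:
  fixes C :: "real set"
  assumes C: "compact C" "C \<noteq> {}" "C \<subseteq> {0..1}"
    and thirds: "\<And>c. c \<in> C \<Longrightarrow> c / 3 \<in> C \<and> (2 + c) / 3 \<in> C"
    and z: "z \<in> {0..2}"
  obtains a b where "a \<in> C" "b \<in> C" "a + b = z"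
proof -
  have approx: "\<exists>a\<in>C. \<exists>b\<in>C. \<bar>a + b - z\<bar> \<le> 2 * (1/3) ^ n" if "z \<in> {0..2}" for n z
    using that
  proof (induction n arbitrary: z)
    case 0
    obtain c where "c \<in> C" using C(2) by auto
    moreover then have "c \<in> {0..1}" using C(3) by auto
    ultimately show ?case using 0 by (intro bexI[of _ c]) (auto simp: abs_le_iff)
  next
    case (Suc n)
    have step: ?case if de: "d \<in> {0, 2}" "e \<in> {0, 2}" and rest: "3 * z - d - e \<in> {0..2}" for d e :: real
    proof -
      obtain a b where ab: "a \<in> C" "b \<in> C" "\<bar>a + b - (3 * z - d - e)\<bar> \<le> 2 * (1/3) ^ n"
        using Suc.IH[OF rest] by blast
      have "(d + a) / 3 \<in> C" "(e + b) / 3 \<in> C"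
        using thirds[OF ab(1)] thirds[OF ab(2)] de by auto
      moreover have "\<bar>(d + a) / 3 + (e + b) / 3 - z\<bar> \<le> 2 * (1/3) ^ Suc n"
        using ab(3) unfolding power_Suc by argo
      ultimately show ?case by blast
    qed
    consider "z \<le> 2/3" | "2/3 \<le> z" "z \<le> 4/3" | "4/3 \<le> z" by linarith
    then show ?case
      using step[of 0 0] step[of 0 2] step[of 2 2] Suc.prems by cases auto
  qed
  have "closed {x + y |x y. x \<in> C \<and> y \<in> C}"
    using C(1) by (intro compact_imp_closed compact_sums)
  moreover have "z \<in> closure {x + y |x y. x \<in> C \<and> y \<in> C}"
  proof (rule closure_approachable[THEN iffD2], intro allI impI)
    fix e :: real assume "0 < e"
    then obtain n where n: "(1/3 :: real) ^ n < e / 2"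
      using real_arch_pow_inv[of "e / 2" "1/3"] by auto
    obtain a b where "a \<in> C" "b \<in> C" "\<bar>a + b - z\<bar> \<le> 2 * (1/3) ^ n"
      using approx[OF z] by blast
    then show "\<exists>y\<in>{x + y |x y. x \<in> C \<and> y \<in> C}. dist y z < e"
      using n by (intro bexI[of _ "a + b"]) (auto simp: dist_real_def)
  qed
  ultimately have "z \<in> {x + y |x y. x \<in> C \<and> y \<in> C}" by simp
  then show thesis using that by blast
qed

lemma stretch_sparse_cantor:
  obtains h :: "real \<Rightarrow> real" where "continuous_on UNIV h" "inj_on h {0..1}" "h ` {0..1} \<subseteq> {0..1}"
    "\<And>z. z \<in> {0..2} \<Longrightarrow> \<exists>a\<in>sparse_cantor. \<exists>b\<in>sparse_cantor. h a + h b = z"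
proof -
  obtain h :: "real \<Rightarrow> real" where h: "continuous_on UNIV h" "h 0 = 0" "h 1 = 1"
    "strict_mono_on {0..1} h" "\<And>u. h u = stretch_step h u"
    using stretch_exists by blast
  have mono: "h u \<le> h v" if "u \<in> {0..1}" "v \<in> {0..1}" "u \<le> v" for u v
    using h(4) that by (meson mono_onD strict_mono_on_imp_mono_on)
  have h01: "h ` {0..1} \<subseteq> {0..1}"
    using mono[of 0] mono[of _ 1] h(2,3) by auto
  have low: "h (y / 9) = h y / 3" and high: "h ((8 + y) / 9) = (2 + h y) / 3" if "y \<in> {0..1}" for y
  proof -
    have "ramp 0 (1/9) (y / 9) = y" "ramp (1/9) (8/9) (y / 9) = 0" "ramp (8/9) 1 (y / 9) = 0"
      using that by (auto simp: ramp_def)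
    then show "h (y / 9) = h y / 3"
      by (subst h(5)) (simp add: stretch_step_def h(2))
    have "ramp 0 (1/9) ((8 + y) / 9) = 1" "ramp (1/9) (8/9) ((8 + y) / 9) = 1"
      "ramp (8/9) 1 ((8 + y) / 9) = y"
      using that by (auto simp: ramp_def field_simps)
    then show "h ((8 + y) / 9) = (2 + h y) / 3"
      by (subst h(5)) (simp add: stretch_step_def h(3))
  qed
  have "\<exists>a\<in>sparse_cantor. \<exists>b\<in>sparse_cantor. h a + h b = z" if "z \<in> {0..2}" for z
  proof -
    have "compact (h ` sparse_cantor)"
      by (rule compact_continuous_image[OF continuous_on_subset[OF h(1)] compact_sparse_cantor]) simp
    moreover have "c / 3 \<in> h ` sparse_cantor \<and> (2 + c) / 3 \<in> h ` sparse_cantor"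
      if "c \<in> h ` sparse_cantor" for c
    proof -
      obtain y where y: "y \<in> sparse_cantor" "c = h y" using \<open>c \<in> h ` sparse_cantor\<close> by auto
      then have "y \<in> {0..1}" using sparse_cantor_subset by auto
      then show ?thesis
        using sparse_cantorI[OF y(1), of 0] sparse_cantorI[OF y(1), of 1] low high y(2)
        by (metis (no_types, lifting) add_0 image_eqI insertCI mult.right_neutral mult_zero_right)
    qed
    moreover have "h ` sparse_cantor \<noteq> {}" "h ` sparse_cantor \<subseteq> {0..1}"
      using zero_in_sparse_cantor sparse_cantor_subset h01 by auto
    ultimately show ?thesis
      using cantor_sum[of "h ` sparse_cantor" z] that by (metis (no_types, lifting) imageE)
  qed
  then show thesis
    using that[OF h(1) strict_mono_on_imp_inj_on[OF h(4)] h01] by blast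
qed

section \<open>Closing up four arcs\<close>

text \<open>
  The reflection of the third coordinate makes the end \<open>(0, 1/9, 0)\<close> of the arc in
  the first column and the start \<open>(0, 8/9, 0)\<close> of its image lie at the same height.
\<close>

definition quarter_turn :: "real ^ 3 \<Rightarrow> real ^ 3" where
  "quarter_turn x = vector [x $ 2, 1 - x $ 1, 1 - x $ 3]"

lemma quarter_turn_nth [simp]:
  "quarter_turn x $ 1 = x $ 2" "quarter_turn x $ 2 = 1 - x $ 1" "quarter_turn x $ 3 = 1 - x $ 3"
  by (simp_all add: quarter_turn_def)

lemma continuous_on_quarter_turn: "continuous_on S quarter_turn"
proof -
  have eq: "quarter_turn = (\<lambda>x. \<chi> i. if i = 1 then x $ 2 else if i = 2 then 1 - x $ 1 else 1 - x $ 3)"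
    by (auto simp: fun_eq_iff vec_eq_iff forall_3)
  have "continuous_on S
      (\<lambda>x :: real ^ 3. if i = 1 then x $ 2 else if i = 2 then 1 - x $ 1 else 1 - x $ 3)" for i :: 3
    by (cases "i = 1"; cases "i = 2") (auto intro!: continuous_intros)
  then show ?thesis
    by (subst eq) (rule continuous_on_vec_lambda)
qed

lemma inj_quarter_turn: "inj_on quarter_turn S"
  by (rule inj_onI) (simp add: vec_eq_iff forall_3)

lemma arc_quarter_turn: "arc \<gamma> \<Longrightarrow> arc (quarter_turn \<circ> \<gamma>)"
  by (intro arc_compose continuous_on_quarter_turn inj_quarter_turn)

lemma convex_unit_cube: "convex unit_cube" and compact_unit_cube: "compact unit_cube"
proof -
  have eq: "unit_cube = cbox 0 1"
    by (auto simp: unit_cube_def mem_box_cart)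
  show "convex unit_cube" unfolding eq by (rule convex_box)
  show "compact unit_cube" unfolding eq by (rule compact_cbox)
qed

text \<open>
  The signs of the functional \<open>2 y - 4 x - z\<close> decide which corners of the column are its minimum and
  its maximum, and so where the arc starts and ends.
\<close>

lemma arc_through_column:
  obtains \<gamma> :: "real \<Rightarrow> real ^ 3" where "arc \<gamma>"
    "pathstart \<gamma> = vector [1/9, 0, 1]" "pathfinish \<gamma> = vector [0, 1/9, 0]"
    "\<And>x. x $ 1 \<in> sparse_cantor \<Longrightarrow> x $ 1 \<le> 1/9 \<Longrightarrow> x $ 2 \<in> sparse_cantor \<Longrightarrow> x $ 2 \<le> 1/9 \<Longrightarrow>
      x $ 3 \<in> sparse_cantor \<Longrightarrow> x \<in> path_image \<gamma>"
    "path_image \<gamma> \<subseteq> {x \<in> unit_cube. x $ 1 \<le> 1/9 \<and> x $ 2 \<le> 1/9}"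
proof -
  define K :: "(real ^ 3) set" where "K = {x. x $ 1 \<in> sparse_cantor \<and> x $ 1 \<le> 1/9 \<and>
    x $ 2 \<in> sparse_cantor \<and> x $ 2 \<le> 1/9 \<and> x $ 3 \<in> sparse_cantor}"
  define L :: "real ^ 3 \<Rightarrow> real" where "L x = 2 * x $ 2 - 4 * x $ 1 - x $ 3" for x
  have bounds: "0 \<le> x $ 1" "0 \<le> x $ 2" "0 \<le> x $ 3" "x $ 3 \<le> 1" if "x \<in> K" for x
    using that sparse_cantor_subset by (auto simp: K_def)
  have K_cube: "K \<subseteq> {x \<in> unit_cube. x $ 1 \<le> 1/9 \<and> x $ 2 \<le> 1/9}"
    using sparse_cantor_subset by (auto simp: K_def unit_cube_def forall_3)
  have "closed K"
  proof -
    have "closed {x :: real ^ 3. x $ i \<in> sparse_cantor}" for i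
      using continuous_closed_vimage[OF closed_sparse_cantor, of "\<lambda>x. x $ i"]
      by (simp add: vimage_def)
    then show ?thesis
      unfolding K_def
      by (intro closed_Collect_conj closed_Collect_le continuous_intros) auto
  qed
  then have "compact K"
    using compact_Int_closed[OF compact_unit_cube, of K] K_cube
    by (metis (no_types, lifting) Int_absorb1 mem_Collect_eq subsetD subsetI)
  moreover have "linear L"
    by (rule linearI) (auto simp: L_def algebra_simps)
  moreover have "inj_on L K"
  proof (rule inj_onI)
    fix x y assume "x \<in> K" "y \<in> K" "L x = L y"
    then show "x = y"
      \<comment> \<open>Exchanging \<open>x\<close> and \<open>y\<close> in the first and third coordinate accounts for the minus signs.\<close>
      using sparse_cantor_linear_independence[of "y $ 1" "x $ 1" "x $ 2" "y $ 2" "y $ 3" "x $ 3"]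
      by (auto simp: K_def L_def vec_eq_iff forall_3)
  qed
  moreover have ninth: "1/9 \<in> sparse_cantor"
    using sparse_cantorI[OF one_in_sparse_cantor, of 0] by simp
  then have "vector [1/9, 0, 1] \<in> K" "vector [0, 1/9, 0] \<in> K"
    using zero_in_sparse_cantor one_in_sparse_cantor by (auto simp: K_def)
  moreover have "L (vector [1/9, 0, 1]) < L (vector [0, 1/9, 0])"
    by (simp add: L_def)
  moreover have "L (vector [1/9, 0, 1]) \<le> L x \<and> L x \<le> L (vector [0, 1/9, 0])" if "x \<in> K" for x
    using bounds[OF that] that by (auto simp: L_def K_def)
  ultimately obtain \<gamma> where \<gamma>: "arc \<gamma>" "pathstart \<gamma> = vector [1/9, 0, 1]"
    "pathfinish \<gamma> = vector [0, 1/9, 0]" "K \<subseteq> path_image \<gamma>" "path_image \<gamma> \<subseteq> convex hull K"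
    by (rule arc_through_compact)
  have "convex {x \<in> unit_cube. x $ 1 \<le> 1/9 \<and> x $ 2 \<le> 1/9}"
  proof -
    have "convex {x :: real ^ 3. x $ i \<le> 1/9}" for i
      using convex_halfspace_le[of "axis i 1 :: real ^ 3" "1/9"] by (simp add: inner_axis' inner_real_def)
    then have "convex (unit_cube \<inter> {x. x $ 1 \<le> 1/9} \<inter> {x. x $ 2 \<le> 1/9})"
      by (intro convex_Int convex_unit_cube)
    then show ?thesis
      by (rule back_subst[of convex]) auto
  qed
  then have "convex hull K \<subseteq> {x \<in> unit_cube. x $ 1 \<le> 1/9 \<and> x $ 2 \<le> 1/9}"
    by (rule hull_minimal[OF K_cube])
  then have in_box: "path_image \<gamma> \<subseteq> {x \<in> unit_cube. x $ 1 \<le> 1/9 \<and> x $ 2 \<le> 1/9}"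
    by (rule subset_trans[OF \<gamma>(5)])
  show thesis
    by (rule that[OF \<gamma>(1-3) _ in_box]) (auto simp: K_def intro!: subsetD[OF \<gamma>(4)])
qed

text \<open>
  Let \<open>q\<close> be the column arc followed by the segment to the next column. Consecutive images of \<open>q\<close>
  under the quarter turn meet exactly where one ends and the next begins, because \<open>q\<close> stays in
  \<open>x \<le> 1/9\<close>, \<open>y \<le> 8/9\<close> and reaches the plane \<open>y = 8/9\<close> only at its end. Opposite images do not
  meet at all. So two images of \<open>q\<close> form an arc \<open>d\<close>, and \<open>d\<close> with its image under a half turn
  is a simple loop.
\<close>

lemma simple_loop_through_sparse_cantor:
  obtains c :: "real \<Rightarrow> real ^ 3" where "simple_path c" "pathfinish c = pathstart c"
    "path_image c \<subseteq> unit_cube" "{x. \<forall>i. x $ i \<in> sparse_cantor} \<subseteq> path_image c"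
proof -
  obtain \<gamma> :: "real \<Rightarrow> real ^ 3" where \<gamma>: "arc \<gamma>"
    "pathstart \<gamma> = vector [1/9, 0, 1]" "pathfinish \<gamma> = vector [0, 1/9, 0]"
    and cantor_\<gamma>: "\<And>x. x $ 1 \<in> sparse_cantor \<Longrightarrow> x $ 1 \<le> 1/9 \<Longrightarrow> x $ 2 \<in> sparse_cantor \<Longrightarrow>
      x $ 2 \<le> 1/9 \<Longrightarrow> x $ 3 \<in> sparse_cantor \<Longrightarrow> x \<in> path_image \<gamma>"
    and column: "path_image \<gamma> \<subseteq> {x \<in> unit_cube. x $ 1 \<le> 1/9 \<and> x $ 2 \<le> 1/9}"
    by (rule arc_through_column) blast
  define e where "e = linepath (vector [0, 1/9, 0] :: real ^ 3) (vector [0, 8/9, 0])"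
  have edge: "path_image e \<subseteq> {x. x $ 1 = 0 \<and> 1/9 \<le> x $ 2 \<and> x $ 2 \<le> 8/9 \<and> x $ 3 = 0}"
    by (auto simp: e_def closed_segment_def) (simp_all add: field_simps)
  have in_column: "0 \<le> x $ i" "x $ i \<le> 1" "x $ 1 \<le> 1/9" "x $ 2 \<le> 1/9"
    if "x \<in> path_image \<gamma>" for x i
    using subsetD[OF column that] by (auto simp: unit_cube_def)
  have on_edge: "x $ 1 = 0" "1/9 \<le> x $ 2" "x $ 2 \<le> 8/9" "x $ 3 = 0" if "x \<in> path_image e" for x
    using subsetD[OF edge that] by auto
  define q where "q = \<gamma> +++ e"
  have q_ends: "pathstart q = vector [1/9, 0, 1]" "pathfinish q = vector [0, 8/9, 0]"
    by (simp_all add: q_def e_def \<gamma>)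
  have q_image: "path_image q = path_image \<gamma> \<union> path_image e"
    unfolding q_def by (rule path_image_join) (simp add: e_def \<gamma>)
  have q_cube: "path_image q \<subseteq> unit_cube"
  proof
    fix x assume "x \<in> path_image q"
    then consider "x \<in> path_image \<gamma>" | "x \<in> path_image e" unfolding q_image by blast
    then show "x \<in> unit_cube"
    proof cases
      case 1
      then show ?thesis using column by blast
    next
      case 2
      then show ?thesis using on_edge[OF 2] by (simp add: unit_cube_def forall_3)
    qed
  qed
  have "arc q"
    unfolding q_def
  proof (rule arc_join)
    show "arc e" by (auto simp: e_def vec_eq_iff forall_3)
    show "path_image \<gamma> \<inter> path_image e \<subseteq> {pathstart e}"
    proof
      fix x assume "x \<in> path_image \<gamma> \<inter> path_image e"
      then have "x $ 1 = 0" "x $ 2 = 1/9" "x $ 3 = 0"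
        using in_column(4)[of x] on_edge[of x] by auto
      then show "x \<in> {pathstart e}" by (simp add: e_def vec_eq_iff forall_3)
    qed
  qed (simp_all add: \<gamma> e_def)
  have q_bounds: "x $ 1 \<le> 1/9" "x $ 2 \<le> 8/9" "1/9 < x $ 2 \<Longrightarrow> x $ 1 = 0"
    "x $ 2 = 8/9 \<Longrightarrow> x = vector [0, 8/9, 0]" if x: "x \<in> path_image q" for x
  proof -
    consider "x \<in> path_image \<gamma>" | "x \<in> path_image e" using x unfolding q_image by blast
    then have "x $ 1 \<le> 1/9 \<and> x $ 2 \<le> 8/9 \<and> (1/9 < x $ 2 \<longrightarrow> x $ 1 = 0) \<and>
      (x $ 2 = 8/9 \<longrightarrow> x = vector [0, 8/9, 0])"
    proof cases
      case 1
      then show ?thesis using in_column(3,4)[OF 1] by simp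
    next
      case 2
      then show ?thesis using on_edge[OF 2] by (simp add: vec_eq_iff forall_3)
    qed
    then show "x $ 1 \<le> 1/9" "x $ 2 \<le> 8/9" "1/9 < x $ 2 \<Longrightarrow> x $ 1 = 0"
      "x $ 2 = 8/9 \<Longrightarrow> x = vector [0, 8/9, 0]" by auto
  qed
  define d where "d = q +++ (quarter_turn \<circ> q)"
  have join_d: "pathfinish q = pathstart (quarter_turn \<circ> q)"
    by (simp add: pathstart_compose q_ends vec_eq_iff forall_3)
  have d_ends: "pathstart d = vector [1/9, 0, 1]" "pathfinish d = vector [8/9, 1, 1]"
    by (simp_all add: d_def pathfinish_compose q_ends vec_eq_iff forall_3)
  have d_image: "path_image d = path_image q \<union> quarter_turn ` path_image q"
    unfolding d_def by (simp add: path_image_join[OF join_d] path_image_compose)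
  have "arc d"
    unfolding d_def
  proof (rule arc_join)
    show "arc q" "arc (quarter_turn \<circ> q)" using \<open>arc q\<close> by (auto intro: arc_quarter_turn)
    show "path_image q \<inter> path_image (quarter_turn \<circ> q) \<subseteq> {pathstart (quarter_turn \<circ> q)}"
    proof
      fix x assume x: "x \<in> path_image q \<inter> path_image (quarter_turn \<circ> q)"
      then obtain y where y: "y \<in> path_image q" "x = quarter_turn y" by (auto simp: path_image_compose)
      have "x $ 2 = 8/9" using q_bounds(2)[of x] q_bounds(1)[OF y(1)] x y(2) by simp
      then show "x \<in> {pathstart (quarter_turn \<circ> q)}"
        using q_bounds(4)[of x] x join_d q_ends by simp
    qed
  qed (rule join_d)
  \<comment> \<open>In the region \<open>x > 1/9\<close>, the half loop \<open>d\<close> consists of its last segment, which lies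
    in the face \<open>y = 1\<close>. The half turn sends this face to \<open>y = 0\<close>, which separates the halves.\<close>
  have d_bounds: "x $ 1 \<le> 1/9 \<or> x $ 2 = 1 \<and> x $ 1 \<le> 8/9 \<and> (x $ 1 = 8/9 \<longrightarrow> x = vector [8/9, 1, 1])"
    if x: "x \<in> path_image d" for x
  proof (cases "x \<in> path_image q")
    case True
    then show ?thesis using q_bounds(1) by blast
  next
    case False
    then obtain y where y: "y \<in> path_image q" "x = quarter_turn y"
      using x d_image by auto
    then show ?thesis
      using q_bounds[OF y(1)] by (cases "y $ 2 \<le> 1/9") (auto simp: vec_eq_iff forall_3)
  qed
  define d' where "d' = quarter_turn \<circ> (quarter_turn \<circ> d)"
  have d'_ends: "pathstart d' = vector [8/9, 1, 1]" "pathfinish d' = vector [1/9, 0, 1]"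
    by (simp_all add: d'_def pathstart_compose pathfinish_compose d_ends vec_eq_iff forall_3)
  have join_c: "pathfinish d = pathstart d'" by (simp add: d_ends d'_ends)
  have "simple_path (d +++ d')"
  proof (rule simple_path_join_loop)
    show "arc d" "arc d'"
      using \<open>arc d\<close> by (auto simp: d'_def intro!: arc_quarter_turn)
    show "path_image d \<inter> path_image d' \<subseteq> {pathstart d, pathstart d'}"
    proof
      fix x assume x: "x \<in> path_image d \<inter> path_image d'"
      then obtain y where y: "y \<in> path_image d" "x = quarter_turn (quarter_turn y)"
        by (auto simp: d'_def path_image_compose)
      have "x = vector [8/9, 1, 1] \<or> x = vector [1/9, 0, 1]"
        using d_bounds[of x] d_bounds[OF y(1)] x unfolding y(2) by (auto simp: vec_eq_iff forall_3)
      then show "x \<in> {pathstart d, pathstart d'}"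
        by (auto simp: d_ends d'_ends)
    qed
  qed (simp_all add: d_ends d'_ends)
  moreover have "pathfinish (d +++ d') = pathstart (d +++ d')"
    by (simp add: d_ends d'_ends)
  moreover have turns: "path_image (d +++ d') = path_image q \<union> quarter_turn ` path_image q \<union>
      quarter_turn ` quarter_turn ` path_image q \<union>
      quarter_turn ` quarter_turn ` quarter_turn ` path_image q"
    unfolding path_image_join[OF join_c]
    unfolding d'_def path_image_compose d_image image_Un by (simp only: Un_assoc)
  moreover have "quarter_turn x \<in> unit_cube" if "x \<in> unit_cube" for x
    using that by (auto simp: unit_cube_def forall_3)
  then have "path_image (d +++ d') \<subseteq> unit_cube"
    unfolding turns using q_cube by auto
  moreover have "x \<in> path_image (d +++ d')" if x: "\<forall>i. x $ i \<in> sparse_cantor" for x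
  proof -
    have x1: "x $ 1 \<in> sparse_cantor" "1 - x $ 1 \<in> sparse_cantor"
      and x2: "x $ 2 \<in> sparse_cantor" "1 - x $ 2 \<in> sparse_cantor"
      and x3: "x $ 3 \<in> sparse_cantor" "1 - x $ 3 \<in> sparse_cantor"
      using x by (auto intro: reflect_sparse_cantor)
    have in_q: "y \<in> path_image q" if "y $ 1 \<in> sparse_cantor" "y $ 1 \<le> 1/9"
      "y $ 2 \<in> sparse_cantor" "y $ 2 \<le> 1/9" "y $ 3 \<in> sparse_cantor" for y
      using cantor_\<gamma>[OF that] by (simp add: q_image)
    consider "x $ 1 \<le> 1/9" "x $ 2 \<le> 1/9" | "x $ 1 \<le> 1/9" "8/9 \<le> x $ 2"
      | "8/9 \<le> x $ 1" "x $ 2 \<le> 1/9" | "8/9 \<le> x $ 1" "8/9 \<le> x $ 2"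
      using sparse_cantor_cases[OF x1(1)] sparse_cantor_cases[OF x2(1)] by metis
    then show ?thesis
    proof cases
      case 1
      then have "x \<in> path_image q" by (intro in_q x1 x2 x3)
      then show ?thesis by (simp add: turns)
    next
      case 2
      define y :: "real ^ 3" where "y = vector [1 - x $ 2, x $ 1, 1 - x $ 3]"
      have "y \<in> path_image q" using 2 x1 x2 x3 by (intro in_q) (simp_all add: y_def)
      moreover have "x = quarter_turn y" by (simp add: y_def vec_eq_iff forall_3)
      ultimately show ?thesis unfolding turns by blast
    next
      case 3
      define y :: "real ^ 3" where "y = vector [x $ 2, 1 - x $ 1, 1 - x $ 3]"
      have "y \<in> path_image q" using 3 x1 x2 x3 by (intro in_q) (simp_all add: y_def)
      moreover have "x = quarter_turn (quarter_turn (quarter_turn y))"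
        by (simp add: y_def vec_eq_iff forall_3)
      ultimately show ?thesis unfolding turns by blast
    next
      case 4
      define y :: "real ^ 3" where "y = vector [1 - x $ 1, 1 - x $ 2, x $ 3]"
      have "y \<in> path_image q" using 4 x1 x2 x3 by (intro in_q) (simp_all add: y_def)
      moreover have "x = quarter_turn (quarter_turn y)" by (simp add: y_def vec_eq_iff forall_3)
      ultimately show ?thesis unfolding turns by blast
    qed
  qed
  ultimately show thesis
    using that[of "d +++ d'"] by blast
qed

lemma simple_closed_curve_of_loop:
  fixes c :: "real \<Rightarrow> 'a::t2_space"
  assumes "simple_path c" "pathfinish c = pathstart c"
  obtains \<gamma> :: "real ^ 2 \<Rightarrow> 'a" where "simple_closed_curve \<gamma>" "\<gamma> ` sphere 0 1 = path_image c"
proof -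
  have "path_image c homeomorphic sphere (0 :: complex) 1"
    using homeomorphic_simple_path_image_circle[OF assms] by simp
  moreover have "sphere (0 :: complex) 1 homeomorphic sphere (0 :: real ^ 2) 1"
    by (rule homeomorphic_spheres_gen) auto
  ultimately have "sphere (0 :: real ^ 2) 1 homeomorphic path_image c"
    using homeomorphic_trans homeomorphic_sym by blast
  then obtain f g where fg: "homeomorphism (sphere (0 :: real ^ 2) 1) (path_image c) f g"
    unfolding homeomorphic_def by blast
  then have "inj_on f (sphere 0 1)"
    by (metis homeomorphism_apply1 inj_on_inverseI)
  then show thesis
    using that[of f] fg by (auto simp: simple_closed_curve_def homeomorphism_def)
qed

theorem theorem2:
  shows "\<exists>(\<gamma> :: real ^ 2 \<Rightarrow> real ^ 3) \<Gamma>. simple_closed_curve \<gamma> \<and> \<Gamma> = \<gamma> ` sphere 0 1 \<and>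
    (*\<^sub>R) (1/2) ` (\<Gamma> + \<Gamma>) = unit_cube \<and> unit_cube = convex hull \<Gamma>"
proof -
  obtain c :: "real \<Rightarrow> real ^ 3" where c: "simple_path c" "pathfinish c = pathstart c"
    "path_image c \<subseteq> unit_cube" "{x. \<forall>i. x $ i \<in> sparse_cantor} \<subseteq> path_image c"
    by (rule simple_loop_through_sparse_cantor)
  obtain \<beta> :: "real ^ 2 \<Rightarrow> real ^ 3" where \<beta>: "simple_closed_curve \<beta>" "\<beta> ` sphere 0 1 = path_image c"
    by (rule simple_closed_curve_of_loop[OF c(1,2)])
  obtain h :: "real \<Rightarrow> real" where h: "continuous_on UNIV h" "inj_on h {0..1}" "h ` {0..1} \<subseteq> {0..1}"
    "\<And>z. z \<in> {0..2} \<Longrightarrow> \<exists>a\<in>sparse_cantor. \<exists>b\<in>sparse_cantor. h a + h b = z"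
    using stretch_sparse_cantor by blast
  define H :: "real ^ 3 \<Rightarrow> real ^ 3" where "H x = (\<chi> i. h (x $ i))" for x
  have contH: "continuous_on S H" for S
    unfolding H_def
    by (intro continuous_on_vec_lambda continuous_on_compose2[OF h(1)] continuous_intros) auto
  have injH: "inj_on H unit_cube"
    using h(2) by (auto simp: inj_on_def H_def unit_cube_def vec_eq_iff)
  define \<Gamma> where "\<Gamma> = (H \<circ> \<beta>) ` sphere 0 1"
  have \<Gamma>: "\<Gamma> = H ` path_image c"
    by (simp add: \<Gamma>_def image_comp flip: \<beta>(2))
  have "simple_closed_curve (H \<circ> \<beta>)"
    using \<beta> c(3) continuous_on_compose[OF _ contH] comp_inj_on[OF _ inj_on_subset[OF injH]]
    unfolding simple_closed_curve_def by metis
  moreover have \<Gamma>_cube: "\<Gamma> \<subseteq> unit_cube"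
    using c(3) h(3) by (force simp: \<Gamma> H_def unit_cube_def)
  have hull_cube: "convex hull \<Gamma> \<subseteq> unit_cube"
    by (intro hull_minimal \<Gamma>_cube convex_unit_cube)
  have mid_hull: "(*\<^sub>R) (1/2) ` (\<Gamma> + \<Gamma>) \<subseteq> convex hull \<Gamma>"
  proof clarify
    fix x assume "x \<in> \<Gamma> + \<Gamma>"
    then obtain a b where ab: "a \<in> \<Gamma>" "b \<in> \<Gamma>" "x = a + b"
      by (rule set_plus_elim)
    have "(1/2) *\<^sub>R a + (1/2) *\<^sub>R b \<in> convex hull \<Gamma>"
      using ab by (intro convexD[OF convex_convex_hull] hull_inc) auto
    then show "(1/2) *\<^sub>R x \<in> convex hull \<Gamma>"
      by (simp add: ab(3) scaleR_add_right)
  qed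
  have cube_mid: "unit_cube \<subseteq> (*\<^sub>R) (1/2) ` (\<Gamma> + \<Gamma>)"
  proof
    fix z :: "real ^ 3" assume z: "z \<in> unit_cube"
    have "\<exists>a b. a \<in> sparse_cantor \<and> b \<in> sparse_cantor \<and> h a + h b = 2 * z $ i" for i
      using h(4)[of "2 * z $ i"] z by (auto simp: unit_cube_def)
    then obtain a b where ab: "\<And>i. a i \<in> sparse_cantor" "\<And>i. b i \<in> sparse_cantor"
      "\<And>i. h (a i) + h (b i) = 2 * z $ i"
      by metis
    have "vec_lambda a \<in> path_image c" "vec_lambda b \<in> path_image c"
      using ab by (auto intro!: subsetD[OF c(4)])
    then have "H (vec_lambda a) \<in> \<Gamma>" "H (vec_lambda b) \<in> \<Gamma>"
      by (auto simp: \<Gamma>)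
    then have "H (vec_lambda a) + H (vec_lambda b) \<in> \<Gamma> + \<Gamma>"
      by (rule set_plus_intro)
    moreover have "z = (1/2) *\<^sub>R (H (vec_lambda a) + H (vec_lambda b))"
      by (simp add: vec_eq_iff H_def ab(3))
    ultimately show "z \<in> (*\<^sub>R) (1/2) ` (\<Gamma> + \<Gamma>)" by blast
  qed
  ultimately show ?thesis
    using hull_cube mid_hull cube_mid \<Gamma>_def
    by (intro exI[of _ "H \<circ> \<beta>"] exI[of _ \<Gamma>]) auto
qed

end
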